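(* Suppose that $\mathcal{B}$ is an RKBS on a set $X$ and that its $\delta$-dual space $\mathcal{B}'$ is isometrically isomorphic to a Banach space of functions on a set $X'$, with which $\mathcal{B}'$ is identified by a fixed isometric isomorphism. Then there exists a unique function $K:X\times X'\to\mathbb{R}$ such that the following statements hold. (1) For each $x\in X$, $K(x,\cdot)\in\mathcal{B}'$ and $f(x)=\langle K(x,\cdot),f\rangle_{\mathcal{B}}$ for all $f\in\mathcal{B}$. (2) The linear span $\mathrm{span}\{K(x,\cdot):x\in X\}$ is dense in $\mathcal{B}'$.
   Context: A Banach space $\mathcal{B}$ is a Banach space of functions on $X$ if its elements are (real-valued) functions on $X$ and, for each $f\in\mathcal{B}$, $\|f\|_{\mathcal{B}}=0$ implies $f(x)=0$ for all $x\in X$. It is an RKBS (reproducing kernel Banach space) on $X$ if each point evaluation functional $\delta_x:f\mapsto f(x)$, $x\in X$, is continuous on $\mathcal{B}$. The $\delta$-dual space $\mathcal{B}'$ is the norm closure in $\mathcal{B}^*$ of $\mathrm{span}\{\delta_x:x\in X\}$. If $J:\mathcal{B}'\to\mathcal{F}$ is the fixed isometric isomorphism onto the Banach space $\mathcal{F}$ of functions on $X'$, then for $g\in\mathcal{F}$ the notation $g\in\mathcal{B}'$, $\langle g,f\rangle_{\mathcal{B}}$ means $\langle J^{-1}g,f\rangle_{\mathcal{B}}=(J^{-1}g)(f)$. *)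

theory Defs
  imports "HOL-Analysis.Analysis" "HOL-Library.Function_Algebras"
begin

(* Pointwise scalar multiplication; the pointwise +, - and 0 come from Function_Algebras.
   This makes the library's subspace and span available for sets of functions. *)

instantiation "fun" :: (type, real_vector) real_vector
begin

definition scaleR_fun :: "real \<Rightarrow> ('a \<Rightarrow> 'b) \<Rightarrow> 'a \<Rightarrow> 'b"
  where "scaleR_fun c f = (\<lambda>x. c *\<^sub>R f x)"

instance
  by standard (simp_all add: scaleR_fun_def plus_fun_def fun_eq_iff algebra_simps)

end

(* Real functions on a set X are encoded as total functions that vanish outside X.
   This is closed under the pointwise operations, unlike "extensional". *)

definition functions_on :: "'a set \<Rightarrow> ('a \<Rightarrow> real) set"
  where "functions_on X = {f. \<forall>x. x \<notin> X \<longrightarrow> f x = 0}"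

(* A normed space is a pair of a carrier V, a linear subspace of an ambient vector space, and
   a function N whose values matter only on V. *)

locale normed_space =
  fixes V :: "'v::real_vector set" and N :: "'v \<Rightarrow> real"
  assumes subspace: "subspace V"
    and norm_nonneg: "v \<in> V \<Longrightarrow> 0 \<le> N v"
    and norm_eq_zero: "v \<in> V \<Longrightarrow> N v = 0 \<longleftrightarrow> v = 0"
    and norm_scale: "v \<in> V \<Longrightarrow> N (c *\<^sub>R v) = \<bar>c\<bar> * N v"
    and norm_triangle: "v \<in> V \<Longrightarrow> w \<in> V \<Longrightarrow> N (v + w) \<le> N v + N w"

locale banach_space = normed_space V N
  for V :: "'v::real_vector set" and N :: "'v \<Rightarrow> real" +
  assumes complete:
    "(\<forall>n. s n \<in> V) \<Longrightarrow> (\<forall>e>0. \<exists>n0. \<forall>m\<ge>n0. \<forall>n\<ge>n0. N (s m - s n) < e)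
      \<Longrightarrow> \<exists>v\<in>V. (\<lambda>n. N (s n - v)) \<longlonglongrightarrow> 0"

definition norm_closure :: "'v::real_vector set \<Rightarrow> ('v \<Rightarrow> real) \<Rightarrow> 'v set \<Rightarrow> 'v set"
  where "norm_closure V N S = {v \<in> V. \<forall>e>0. \<exists>s\<in>S. N (v - s) < e}"

definition norm_dense :: "'v::real_vector set \<Rightarrow> ('v \<Rightarrow> real) \<Rightarrow> 'v set \<Rightarrow> bool"
  where "norm_dense V N S \<longleftrightarrow> S \<subseteq> V \<and> norm_closure V N S = V"

definition isometric_isomorphism ::
    "'v::real_vector set \<Rightarrow> ('v \<Rightarrow> real) \<Rightarrow> 'w::real_vector set \<Rightarrow> ('w \<Rightarrow> real) \<Rightarrow> ('v \<Rightarrow> 'w) \<Rightarrow> bool"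
  where "isometric_isomorphism V N W M J \<longleftrightarrow>
    bij_betw J V W \<and>
    (\<forall>u\<in>V. \<forall>v\<in>V. J (u + v) = J u + J v) \<and>
    (\<forall>c. \<forall>v\<in>V. J (c *\<^sub>R v) = c *\<^sub>R J v) \<and>
    (\<forall>v\<in>V. M (J v) = N v)"

definition linear_functional_on :: "'v::real_vector set \<Rightarrow> ('v \<Rightarrow> real) \<Rightarrow> bool"
  where "linear_functional_on V \<phi> \<longleftrightarrow>
    (\<forall>u\<in>V. \<forall>v\<in>V. \<phi> (u + v) = \<phi> u + \<phi> v) \<and> (\<forall>c. \<forall>v\<in>V. \<phi> (c *\<^sub>R v) = c * \<phi> v)"

definition norm_continuous_on :: "'v::real_vector set \<Rightarrow> ('v \<Rightarrow> real) \<Rightarrow> ('v \<Rightarrow> real) \<Rightarrow> bool"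
  where "norm_continuous_on V N \<phi> \<longleftrightarrow>
    (\<forall>v\<in>V. \<forall>e>0. \<exists>d>0. \<forall>u\<in>V. N (u - v) < d \<longrightarrow> \<bar>\<phi> u - \<phi> v\<bar> < e)"

(* Functionals on V are functions on V in the sense above, i.e. zero outside V. *)

definition dual_space :: "'v::real_vector set \<Rightarrow> ('v \<Rightarrow> real) \<Rightarrow> ('v \<Rightarrow> real) set"
  where "dual_space V N =
    {\<phi> \<in> functions_on V. linear_functional_on V \<phi> \<and> norm_continuous_on V N \<phi>}"

definition dual_norm :: "'v::real_vector set \<Rightarrow> ('v \<Rightarrow> real) \<Rightarrow> ('v \<Rightarrow> real) \<Rightarrow> real"
  where "dual_norm V N \<phi> = (SUP v\<in>{v \<in> V. N v \<le> 1}. \<bar>\<phi> v\<bar>)"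

(* Here the zero vector is the zero function, so norm_zero_pointwise follows from
   definiteness of the norm; it is listed because it is part of the notion
   (it is what rules out spaces of equivalence classes of functions). *)

locale banach_function_space = banach_space B N
  for X :: "'x set" and B :: "('x \<Rightarrow> real) set" and N :: "('x \<Rightarrow> real) \<Rightarrow> real" +
  assumes carrier_functions: "B \<subseteq> functions_on X"
    and norm_zero_pointwise: "f \<in> B \<Longrightarrow> N f = 0 \<Longrightarrow> x \<in> X \<Longrightarrow> f x = 0"

definition point_eval :: "('x \<Rightarrow> real) set \<Rightarrow> 'x \<Rightarrow> ('x \<Rightarrow> real) \<Rightarrow> real"
  where "point_eval B x = (\<lambda>f. if f \<in> B then f x else 0)"

locale rkbs = banach_function_space X B N
  for X :: "'x set" and B :: "('x \<Rightarrow> real) set" and N :: "('x \<Rightarrow> real) \<Rightarrow> real" +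
  assumes point_eval_continuous: "x \<in> X \<Longrightarrow> norm_continuous_on B N (point_eval B x)"

definition delta_dual ::
    "'x set \<Rightarrow> ('x \<Rightarrow> real) set \<Rightarrow> (('x \<Rightarrow> real) \<Rightarrow> real) \<Rightarrow> (('x \<Rightarrow> real) \<Rightarrow> real) set"
  where "delta_dual X B N =
    norm_closure (dual_space B N) (dual_norm B N) (span (point_eval B ` X))"

(* The pairing of g, an element of the space identified with the delta-dual D through J,
   with f. *)

definition dual_pairing ::
    "(('x \<Rightarrow> real) \<Rightarrow> real) set \<Rightarrow> ((('x \<Rightarrow> real) \<Rightarrow> real) \<Rightarrow> 'g) \<Rightarrow> 'g \<Rightarrow> ('x \<Rightarrow> real) \<Rightarrow> real"
  where "dual_pairing D J g f = inv_into D J g f"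

end

theory Submission
  imports Defs
begin

text \<open>
  A reproducing kernel is the family of point evaluations seen through the identification
  \<open>J\<close>: the only candidate is \<open>K (x, \<cdot>) = J \<delta>\<^sub>x\<close>.

  The reproducing property says that the functional \<open>J\<inverse> (K (x, \<cdot>))\<close> agrees with \<open>\<delta>\<^sub>x\<close> on
  all of \<open>B\<close>, and a functional is determined by its values on \<open>B\<close>; since \<open>J\<close> is injective,
  existence and uniqueness of \<open>K (x, \<cdot>)\<close> both follow, once \<open>\<delta>\<^sub>x\<close> is known to lie in the domain
  of \<open>J\<close> (\<open>span_point_eval_subset_delta_dual\<close>). Continuity of the point evaluations
  enters exactly there.

  Density holds because the \<delta>-dual is by construction the closure of the span of the
  point evaluations, and a linear isometry onto \<open>F\<close> carries a dense span to a dense span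
  (\<open>isometric_isomorphism_dense_span\<close>).
\<close>

lemma scaleR_fun_apply: "(c *\<^sub>R f) x = c *\<^sub>R f x"
  by (simp add: scaleR_fun_def)

lemma subspace_functions_on: "subspace (functions_on X)"
  by (auto simp: subspace_def functions_on_def zero_fun_def plus_fun_def scaleR_fun_def)

lemma norm_continuous_on_add:
  assumes "norm_continuous_on V N \<phi>" and "norm_continuous_on V N \<psi>"
  shows "norm_continuous_on V N (\<phi> + \<psi>)"
  unfolding norm_continuous_on_def
proof (intro ballI allI impI)
  fix v and e :: real
  assume v: "v \<in> V" and "0 < e"
  then have e2: "0 < e / 2" by simp
  obtain d1 where d1: "d1 > 0" "\<And>u. u \<in> V \<Longrightarrow> N (u - v) < d1 \<Longrightarrow> \<bar>\<phi> u - \<phi> v\<bar> < e / 2"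
    using assms(1) v e2 unfolding norm_continuous_on_def by blast
  obtain d2 where d2: "d2 > 0" "\<And>u. u \<in> V \<Longrightarrow> N (u - v) < d2 \<Longrightarrow> \<bar>\<psi> u - \<psi> v\<bar> < e / 2"
    using assms(2) v e2 unfolding norm_continuous_on_def by blast
  have "\<bar>(\<phi> + \<psi>) u - (\<phi> + \<psi>) v\<bar> < e" if "u \<in> V" "N (u - v) < min d1 d2" for u
    using d1(2)[OF that(1)] d2(2)[OF that(1)] that(2) unfolding plus_fun_apply by linarith
  then show "\<exists>d>0. \<forall>u\<in>V. N (u - v) < d \<longrightarrow> \<bar>(\<phi> + \<psi>) u - (\<phi> + \<psi>) v\<bar> < e"
    using d1(1) d2(1) by (intro exI[of _ "min d1 d2"]) auto
qed

lemma norm_continuous_on_scaleR: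
  assumes "norm_continuous_on V N \<phi>"
  shows "norm_continuous_on V N (c *\<^sub>R \<phi>)"
  unfolding norm_continuous_on_def
proof (intro ballI allI impI)
  fix v and e :: real
  assume v: "v \<in> V" and e: "0 < e"
  \<comment> \<open>The summand 1 keeps the denominator positive when \<open>c = 0\<close>.\<close>
  then have "0 < e / (\<bar>c\<bar> + 1)" by simp
  then obtain d where d: "d > 0"
      "\<And>u. u \<in> V \<Longrightarrow> N (u - v) < d \<Longrightarrow> \<bar>\<phi> u - \<phi> v\<bar> < e / (\<bar>c\<bar> + 1)"
    using assms v unfolding norm_continuous_on_def by blast
  have "\<bar>(c *\<^sub>R \<phi>) u - (c *\<^sub>R \<phi>) v\<bar> < e" if "u \<in> V" "N (u - v) < d" for u
  proof -
    have "\<bar>(c *\<^sub>R \<phi>) u - (c *\<^sub>R \<phi>) v\<bar> = \<bar>c\<bar> * \<bar>\<phi> u - \<phi> v\<bar>"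
      by (simp add: scaleR_fun_def flip: abs_mult right_diff_distrib)
    also have "\<dots> \<le> (\<bar>c\<bar> + 1) * \<bar>\<phi> u - \<phi> v\<bar>"
      by (simp add: mult_right_mono)
    also have "\<dots> < e"
      using d(2)[OF that] by (simp add: pos_less_divide_eq mult.commute)
    finally show ?thesis .
  qed
  then show "\<exists>d>0. \<forall>u\<in>V. N (u - v) < d \<longrightarrow> \<bar>(c *\<^sub>R \<phi>) u - (c *\<^sub>R \<phi>) v\<bar> < e"
    using d(1) by blast
qed

lemma subspace_dual_space: "subspace (dual_space V N)"
proof (rule subspaceI)
  show "0 \<in> dual_space V N"
    using subspace_0[OF subspace_functions_on]
    by (auto simp: dual_space_def linear_functional_on_def norm_continuous_on_def zero_fun_def
        intro: exI[of _ 1])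
next
  fix \<phi> \<psi> assume "\<phi> \<in> dual_space V N" "\<psi> \<in> dual_space V N"
  then show "\<phi> + \<psi> \<in> dual_space V N"
    by (simp add: dual_space_def linear_functional_on_def distrib_left
        norm_continuous_on_add subspace_add[OF subspace_functions_on])
next
  fix c \<phi> assume "\<phi> \<in> dual_space V N"
  then show "c *\<^sub>R \<phi> \<in> dual_space V N"
    by (simp add: dual_space_def linear_functional_on_def scaleR_fun_apply distrib_left
        norm_continuous_on_scaleR subspace_scale[OF subspace_functions_on])
qed

lemma (in normed_space) dual_norm_zero: "dual_norm V N 0 = 0"
proof -
  have "0 \<in> {v \<in> V. N v \<le> 1}"
    using norm_eq_zero[of 0] subspace_0[OF subspace] by simp
  then have "{v \<in> V. N v \<le> 1} \<noteq> {}" by blast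
  then show ?thesis by (simp add: dual_norm_def zero_fun_def)
qed

lemma (in rkbs) point_eval_in_dual_space:
  assumes "x \<in> X"
  shows "point_eval B x \<in> dual_space B N"
  using point_eval_continuous[OF assms] subspace
  by (simp add: dual_space_def functions_on_def linear_functional_on_def point_eval_def
      subspace_add subspace_scale scaleR_fun_apply)

lemma (in rkbs) span_point_eval_subset_delta_dual:
  "span (point_eval B ` X) \<subseteq> delta_dual X B N"
proof -
  have "span (point_eval B ` X) \<subseteq> dual_space B N"
    using point_eval_in_dual_space by (intro span_minimal subspace_dual_space) auto
  moreover have "\<exists>q\<in>span (point_eval B ` X). dual_norm B N (p - q) < e"
    if "p \<in> span (point_eval B ` X)" "0 < e" for p and e :: real
    using that dual_norm_zero by (intro bexI[of _ p]) simp_all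
  ultimately show ?thesis
    unfolding delta_dual_def norm_closure_def by blast
qed

text \<open>
  The approximants of \<open>v - s\<close> are those of \<open>v\<close> shifted by \<open>s\<close>. The point
  is that an approximation error \<open>v - s\<close> stays in the closure, so that an isometry given
  only on the closure can be applied to it.
\<close>

lemma norm_closure_diff:
  assumes "subspace V" and "subspace S" and "v \<in> norm_closure V N S" and "s \<in> S" and "s \<in> V"
  shows "v - s \<in> norm_closure V N S"
  unfolding norm_closure_def
proof (intro CollectI conjI allI impI)
  show "v - s \<in> V"
    using assms subspace_diff by (auto simp: norm_closure_def)
next
  fix e :: real assume "0 < e"
  then obtain s' where "s' \<in> S" "N (v - s') < e"
    using assms(3) by (auto simp: norm_closure_def)
  then show "\<exists>t\<in>S. N (v - s - t) < e"
    using subspace_diff[OF assms(2)] assms(4) by (intro bexI[of _ "s' - s"]) auto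
qed

text \<open>
  Every element of the target is \<open>J v\<close> for some \<open>v\<close> in the closure. If \<open>s\<close> in the span of \<open>A\<close>
  approximates \<open>v\<close>, then \<open>J s\<close> lies in the span of \<open>J ` A\<close> and approximates \<open>J v\<close> equally well.
\<close>

lemma isometric_isomorphism_dense_span:
  assumes V: "subspace V" and W: "subspace W"
    and span_sub: "span A \<subseteq> norm_closure V N (span A)"
    and J: "isometric_isomorphism (norm_closure V N (span A)) N W M J"
  shows "norm_dense W M (span (J ` A))"
proof -
  let ?D = "norm_closure V N (span A)"
  have bij: "bij_betw J ?D W"
    and add: "\<And>u v. u \<in> ?D \<Longrightarrow> v \<in> ?D \<Longrightarrow> J (u + v) = J u + J v"
    and scale: "\<And>c v. v \<in> ?D \<Longrightarrow> J (c *\<^sub>R v) = c *\<^sub>R J v"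
    and iso: "\<And>v. v \<in> ?D \<Longrightarrow> M (J v) = N v"
    using J by (auto simp: isometric_isomorphism_def)
  have "J ` A \<subseteq> W"
    using bij_betwE[OF bij] subset_trans[OF span_superset span_sub] by blast
  then have sub: "span (J ` A) \<subseteq> W"
    using W by (rule span_minimal)
  note in_D = subsetD[OF span_sub]
  \<comment> \<open>Membership in \<open>span A\<close> is carried along because \<open>J\<close> is additive only on the closure.\<close>
  have J_span: "s \<in> span A \<and> J s \<in> span (J ` A)" if "s \<in> span A" for s
    using that
  proof (induction rule: span_induct_alt)
    case base
    have "J 0 = 0" using scale[OF in_D[OF span_zero], of 0] by simp
    then show ?case by (simp add: span_zero)
  next
    case (step c a p)
    then have p: "p \<in> span A" "J p \<in> span (J ` A)" by simp_all
    have a: "a \<in> span A" using step(1) by (rule span_base)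
    have "J (c *\<^sub>R a + p) = c *\<^sub>R J a + J p"
      using add[OF in_D[OF span_scale[OF a]] in_D[OF p(1)]] scale[OF in_D[OF a]] by simp
    then show ?case
      using a p step(1) by (simp add: span_add span_base span_scale)
  qed
  have "\<exists>t\<in>span (J ` A). M (w - t) < e" if "w \<in> W" "0 < e" for w and e :: real
  proof -
    obtain v where v: "v \<in> ?D" "w = J v"
      using bij \<open>w \<in> W\<close> by (auto simp: bij_betw_def)
    then obtain s where s: "s \<in> span A" "N (v - s) < e"
      using \<open>0 < e\<close> by (auto simp: norm_closure_def)
    have sD: "s \<in> ?D" using s(1) by (rule in_D)
    then have "s \<in> V" by (simp add: norm_closure_def)
    then have diff: "v - s \<in> ?D"
      using norm_closure_diff[OF V subspace_span v(1) s(1)] by simp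
    have "w - J s = J (v - s)"
      using add[OF diff sD] v(2) by simp
    then have "M (w - J s) < e"
      using iso[OF diff] s(2) by simp
    then show ?thesis using J_span[OF s(1)] by (intro bexI[of _ "J s"]) simp_all
  qed
  then show ?thesis
    using sub unfolding norm_dense_def norm_closure_def by blast
qed

text \<open>
  Functionals vanish outside their carrier, so the values on \<open>B\<close> determine them.
\<close>

lemma point_eval_eqI:
  assumes "\<phi> \<in> dual_space B N" and "\<And>f. f \<in> B \<Longrightarrow> \<phi> f = f x"
  shows "\<phi> = point_eval B x"
  using assms by (auto simp: dual_space_def functions_on_def point_eval_def)

text \<open>
  From left to right this gives the uniqueness of the kernel, from right to left its existence.
\<close>

lemma reproducing_iff_eq_point_eval:
  assumes D: "D \<subseteq> dual_space B N" and J: "bij_betw J D F" and \<delta>: "point_eval B x \<in> D"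
  shows "g \<in> F \<and> (\<forall>f\<in>B. f x = dual_pairing D J g f) \<longleftrightarrow> g = J (point_eval B x)"
proof
  assume g: "g \<in> F \<and> (\<forall>f\<in>B. f x = dual_pairing D J g f)"
  then have "g \<in> J ` D" using J by (simp add: bij_betw_def)
  then have "inv_into D J g \<in> D" and gJ: "J (inv_into D J g) = g"
    by (rule inv_into_into, rule f_inv_into_f)
  moreover have "inv_into D J g f = f x" if "f \<in> B" for f
    using g that by (simp add: dual_pairing_def)
  ultimately have "inv_into D J g = point_eval B x"
    using D by (intro point_eval_eqI) auto
  with gJ show "g = J (point_eval B x)" by simp
next
  assume "g = J (point_eval B x)"
  then show "g \<in> F \<and> (\<forall>f\<in>B. f x = dual_pairing D J g f)"
    using bij_betwE[OF J] \<delta> bij_betw_inv_into_left[OF J \<delta>]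
    by (auto simp: dual_pairing_def point_eval_def)
qed

theorem proposition4:
  fixes X :: "'x set" and X' :: "'y set"
    and B :: "('x \<Rightarrow> real) set" and normB :: "('x \<Rightarrow> real) \<Rightarrow> real"
    and F :: "('y \<Rightarrow> real) set" and normF :: "('y \<Rightarrow> real) \<Rightarrow> real"
    and J :: "(('x \<Rightarrow> real) \<Rightarrow> real) \<Rightarrow> ('y \<Rightarrow> real)"
  assumes "rkbs X B normB"
    and "banach_function_space X' F normF"
    and "isometric_isomorphism (delta_dual X B normB) (dual_norm B normB) F normF J"
  shows "\<exists>!K :: 'x \<times> 'y \<Rightarrow> real. K \<in> functions_on (X \<times> X') \<and>
    (\<forall>x\<in>X. (\<lambda>t. K (x, t)) \<in> F \<and>
      (\<forall>f\<in>B. f x = dual_pairing (delta_dual X B normB) J (\<lambda>t. K (x, t)) f)) \<and>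
    norm_dense F normF (span ((\<lambda>x t. K (x, t)) ` X))"
proof -
  interpret B: rkbs X B normB by fact
  interpret F: banach_function_space X' F normF by fact
  let ?D = "delta_dual X B normB"
  let ?\<delta> = "point_eval B"
  have bij: "bij_betw J ?D F"
    using assms(3) by (simp add: isometric_isomorphism_def)
  have D_sub: "?D \<subseteq> dual_space B normB"
    by (auto simp: delta_dual_def norm_closure_def)
  have \<delta>_mem: "?\<delta> x \<in> ?D" if "x \<in> X" for x
    using that B.span_point_eval_subset_delta_dual span_base by blast
  note reproducing = reproducing_iff_eq_point_eval[OF D_sub bij \<delta>_mem]
  have dense: "norm_dense F normF (span (J ` ?\<delta> ` X))"
    using assms(3) B.span_point_eval_subset_delta_dual unfolding delta_dual_def
    by (intro isometric_isomorphism_dense_span[OF subspace_dual_space F.subspace])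
  define K where "K = (\<lambda>(x, t). if x \<in> X then J (?\<delta> x) t else 0)"
  have K_section: "(\<lambda>t. K (x, t)) = J (?\<delta> x)" if "x \<in> X" for x
    using that by (simp add: K_def)
  show ?thesis
  proof (rule ex1I[of _ K], intro conjI)
    have "J (?\<delta> x) \<in> functions_on X'" if "x \<in> X" for x
      using bij_betwE[OF bij] \<delta>_mem[OF that] F.carrier_functions by blast
    then show "K \<in> functions_on (X \<times> X')"
      by (auto simp: K_def functions_on_def)
    show "\<forall>x\<in>X. (\<lambda>t. K (x, t)) \<in> F \<and>
        (\<forall>f\<in>B. f x = dual_pairing ?D J (\<lambda>t. K (x, t)) f)"
      using reproducing K_section by blast
    have "(\<lambda>x t. K (x, t)) ` X = J ` ?\<delta> ` X"
      using K_section by (simp add: image_image)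
    then show "norm_dense F normF (span ((\<lambda>x t. K (x, t)) ` X))"
      using dense by simp
  next
    fix L :: "'x \<times> 'y \<Rightarrow> real"
    assume L: "L \<in> functions_on (X \<times> X') \<and>
      (\<forall>x\<in>X. (\<lambda>t. L (x, t)) \<in> F \<and>
        (\<forall>f\<in>B. f x = dual_pairing ?D J (\<lambda>t. L (x, t)) f)) \<and>
      norm_dense F normF (span ((\<lambda>x t. L (x, t)) ` X))"
    show "L = K"
    proof (rule ext, clarify)
      fix x t
      show "L (x, t) = K (x, t)"
      proof (cases "x \<in> X")
        case True
        then have "(\<lambda>t. L (x, t)) = J (?\<delta> x)"
          using L reproducing by blast
        then show ?thesis
          using K_section[OF True] by metis
      next
        case False
        then show ?thesis
          using L by (simp add: K_def functions_on_def)
      qed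
    qed
  qed
qed

end
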